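(* Let $X$ be a Hausdorff space. The following are equivalent: (1) $X$ is an open, boundary-compact image of a metric space, i.e. there exist a metric space $M$ and a continuous surjection $f:M\to X$ which is both an open map and a boundary-compact map; (2) $X$ has a uniform base at non-isolated points; (3) $X$ has a point-regular base at non-isolated points; (4) $X$ has a point-finite development at non-isolated points.
   Context: All spaces are Hausdorff and all maps are continuous and onto. For a family $\mathcal P$ of subsets of $X$ and $x\in X$, write $(\mathcal P)_x=\{P\in\mathcal P: x\in P\}$ and $\mathrm{st}(x,\mathcal P)=\bigcup (\mathcal P)_x$. A point is non-isolated if $\{x\}$ is not open. A base $\mathcal P$ of $X$ is a uniform base at non-isolated points if for each non-isolated point $x\in X$ and each countably infinite subset $\mathcal P'$ of $(\mathcal P)_x$, $\mathcal P'$ is a neighborhood base at $x$. A base $\mathcal P$ of $X$ is a point-regular base at non-isolated points if for each non-isolated point $x\in X$ and each open $U$ with $x\in U$, the set $\{P\in(\mathcal P)_x: P\not\subset U\}$ is finite. A sequence $\{\mathcal P_n\}_{n\in\mathbb N}$ of families of open subsets of $X$ is a development at non-isolated points if $\{\mathrm{st}(x,\mathcal P_n)\}_{n\in\mathbb N}$ is a neighborhood base at $x$ for each non-isolated point $x\in X$. It is a point-finite development at non-isolated points if moreover, for each $n$, each non-isolated point of $X$ belongs to at most finitely many elements of $\mathcal P_n$. A map $f:M\to X$ is boundary-compact if the boundary $\partial f^{-1}(x)$ is compact for every $x\in X$; it is open if images of open sets are open. *)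

theory Defs
  imports "HOL-Analysis.Analysis"
begin

definition non_isolated :: "'a topology \<Rightarrow> 'a set" where
  "non_isolated X = {x \<in> topspace X. \<not> openin X {x}}"

definition family_at :: "'a set set \<Rightarrow> 'a \<Rightarrow> 'a set set" where
  "family_at \<P> x = {P \<in> \<P>. x \<in> P}"

definition star_at :: "'a \<Rightarrow> 'a set set \<Rightarrow> 'a set" where
  "star_at x \<P> = \<Union>(family_at \<P> x)"

text \<open>Members of a neighborhood base need not be open, but each must be a neighborhood of the
  point. The library's \<open>neighbourhood_base_at x (\<lambda>V. V \<in> \<B>) X\<close> gives only the second conjunct,
  up to the interior: it allows \<open>\<B>\<close> to have members that are not neighborhoods of \<open>x\<close>.\<close>

definition neighborhood_base_of_point :: "'a topology \<Rightarrow> 'a \<Rightarrow> 'a set set \<Rightarrow> bool" where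
  "neighborhood_base_of_point X x \<B> \<longleftrightarrow>
     (\<forall>V\<in>\<B>. V \<subseteq> topspace X \<and> x \<in> X interior_of V) \<and>
     (\<forall>U. openin X U \<and> x \<in> U \<longrightarrow> (\<exists>V\<in>\<B>. V \<subseteq> U))"

definition base_of_space :: "'a topology \<Rightarrow> 'a set set \<Rightarrow> bool" where
  "base_of_space X \<P> \<longleftrightarrow>
     (\<forall>P\<in>\<P>. openin X P) \<and>
     (\<forall>U x. openin X U \<and> x \<in> U \<longrightarrow> (\<exists>P\<in>\<P>. x \<in> P \<and> P \<subseteq> U))"

definition uniform_base_at_non_isolated :: "'a topology \<Rightarrow> 'a set set \<Rightarrow> bool" where
  "uniform_base_at_non_isolated X \<P> \<longleftrightarrow>
     base_of_space X \<P> \<and>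
     (\<forall>x\<in>non_isolated X. \<forall>\<Q>. \<Q> \<subseteq> family_at \<P> x \<and> countable \<Q> \<and> infinite \<Q>
        \<longrightarrow> neighborhood_base_of_point X x \<Q>)"

definition point_regular_base_at_non_isolated :: "'a topology \<Rightarrow> 'a set set \<Rightarrow> bool" where
  "point_regular_base_at_non_isolated X \<P> \<longleftrightarrow>
     base_of_space X \<P> \<and>
     (\<forall>x\<in>non_isolated X. \<forall>U. openin X U \<and> x \<in> U
        \<longrightarrow> finite {P \<in> family_at \<P> x. \<not> P \<subseteq> U})"

text \<open>The families of a development are not required to cover the isolated points.\<close>

definition development_at_non_isolated :: "'a topology \<Rightarrow> (nat \<Rightarrow> 'a set set) \<Rightarrow> bool" where
  "development_at_non_isolated X \<P> \<longleftrightarrow>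
     (\<forall>n. \<forall>P\<in>\<P> n. openin X P) \<and>
     (\<forall>x\<in>non_isolated X. neighborhood_base_of_point X x (range (\<lambda>n. star_at x (\<P> n))))"

definition point_finite_development_at_non_isolated ::
    "'a topology \<Rightarrow> (nat \<Rightarrow> 'a set set) \<Rightarrow> bool" where
  "point_finite_development_at_non_isolated X \<P> \<longleftrightarrow>
     development_at_non_isolated X \<P> \<and>
     (\<forall>n. \<forall>x\<in>non_isolated X. finite (family_at (\<P> n) x))"

definition boundary_compact_map :: "'m topology \<Rightarrow> 'a topology \<Rightarrow> ('m \<Rightarrow> 'a) \<Rightarrow> bool" where
  "boundary_compact_map M X f \<longleftrightarrow>
     (\<forall>x\<in>topspace X. compactin M (M frontier_of {y \<in> topspace M. f y = x}))"

definition open_boundary_compact_surjection ::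
    "'m topology \<Rightarrow> 'a topology \<Rightarrow> ('m \<Rightarrow> 'a) \<Rightarrow> bool" where
  "open_boundary_compact_surjection M X f \<longleftrightarrow>
     continuous_map M X f \<and> f ` topspace M = topspace X \<and>
     open_map M X f \<and> boundary_compact_map M X f"

text \<open>HOL cannot quantify over types inside a proposition, so the type containing the points of the
  metric space is a parameter of the following notion; the metric space itself, of type
  \<open>'m metric\<close>, may have any subset of that type as its carrier.\<close>

definition open_boundary_compact_image_of_metric :: "'m itself \<Rightarrow> 'a topology \<Rightarrow> bool" where
  "open_boundary_compact_image_of_metric _ X \<longleftrightarrow>
     (\<exists>(m :: 'm metric) f. open_boundary_compact_surjection (mtopology_of m) X f)"

end

theory Submission
  imports Defs
begin

text \<open>An open map with compact boundaries of fibres has compact fibres over non-isolated points, because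
  such a fibre has empty interior. Hence the images of locally finite refinements of the covers by
  balls of radius \<open>1 / (n + 1)\<close> form a point-finite development. Conversely, a point-finite
  development yields Ponomarev's space of sequences \<open>\<alpha>\<close> with \<open>\<alpha> n \<in> \<P> n\<close> that form a network at a
  point, inside a product of discrete spaces; fibres over non-isolated points are products of finite
  sets. Finite intersections of members of a development give a point-regular base, and the maximal
  members among those with at least \<open>n\<close> supersets in a point-regular base give back a development.\<close>

text \<open>M. E. Rudin's proof of Stone's theorem.\<close>

lemma (in Metric_space) locally_finite_open_refinement:
  assumes opC: "\<forall>U\<in>\<C>. openin mtopology U" and cov: "M \<subseteq> \<Union>\<C>"
  shows "\<exists>\<V>. (\<forall>D\<in>\<V>. openin mtopology D \<and> (\<exists>U\<in>\<C>. D \<subseteq> U)) \<and> \<Union>\<V> = M \<and>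
           locally_finite_in mtopology \<V>"
proof -
  \<comment> \<open>A well-order of all sets of points gives each point \<open>x\<close> a least
    member \<open>first x\<close> of \<open>\<C>\<close> through it.\<close>
  obtain r :: "'a set rel" where r: "Well_order r" "Field r = UNIV"
    using well_ordering[where ?'a = "'a set"] by (elim exE conjE)
  have wf: "wf (r - Id)" and tot: "Total r"
    using r unfolding well_order_on_def linear_order_on_def by auto
  have "\<forall>x\<in>M. \<exists>U. U \<in> \<C> \<and> x \<in> U \<and> (\<forall>V\<in>\<C>. x \<in> V \<longrightarrow> (V, U) \<notin> r - Id)"
  proof
    fix x assume x: "x \<in> M"
    obtain U0 where "U0 \<in> {U\<in>\<C>. x \<in> U}" using cov x by blast
    from wf[unfolded wf_eq_minimal, rule_format, OF this]
    show "\<exists>U. U \<in> \<C> \<and> x \<in> U \<and> (\<forall>V\<in>\<C>. x \<in> V \<longrightarrow> (V, U) \<notin> r - Id)" by blast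
  qed
  from bchoice[OF this] obtain first where
    "\<forall>x\<in>M. first x \<in> \<C> \<and> x \<in> first x \<and> (\<forall>V\<in>\<C>. x \<in> V \<longrightarrow> (V, first x) \<notin> r - Id)"
    by (elim exE)
  then have first: "\<And>x. x \<in> M \<Longrightarrow> first x \<in> \<C>" "\<And>x. x \<in> M \<Longrightarrow> x \<in> first x"
      "\<And>x V. \<lbrakk>x \<in> M; V \<in> \<C>; x \<in> V\<rbrakk> \<Longrightarrow> (V, first x) \<notin> r - Id"
    by blast+
  \<comment> \<open>\<open>A\<close> holds the centres of level \<open>n\<close>. The radius
    \<open>3/2^n\<close> against \<open>1/2^n\<close> in \<open>G\<close> keeps points of
    \<open>D n U\<close> and \<open>D n U'\<close> more than \<open>1/2^n\<close> apart for distinct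
    \<open>U\<close>, \<open>U'\<close> in \<open>\<C>\<close>. The parameter \<open>E\<close>
    stands for what earlier levels covered, so that the recursion defining it can follow.\<close>
  define A where "A E n U = {x\<in>M. first x = U \<and> x \<notin> E \<and> mball x (3/2^n) \<subseteq> U}" for E and n::nat and U
  define G where "G E n U = (\<Union>x\<in>A E n U. mball x (1/2^n))" for E and n::nat and U
  define E where "E = rec_nat {} (\<lambda>n E. E \<union> (\<Union>U\<in>\<C>. G E n U))"
  define D where "D n U = G (E n) n U" for n U
  have E_Suc: "E (Suc n) = E n \<union> (\<Union>U\<in>\<C>. D n U)" for n
    by (simp add: E_def D_def)
  have E_eq: "E n = (\<Union>j<n. \<Union>U\<in>\<C>. D j U)" for n
  proof (induction n)
    case 0 then show ?case by (simp add: E_def)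
  next
    case (Suc n) then show ?case by (auto simp: E_Suc lessThan_Suc)
  qed
  have D_mem: "\<exists>y\<in>M. first y = U \<and> y \<notin> E n \<and> mball y (3/2^n) \<subseteq> U \<and> d y p < 1/2^n \<and> p \<in> M"
    if "p \<in> D n U" for p n U
    using that by (auto simp: D_def G_def A_def)
  have D_open: "openin mtopology (D n U)" for n U
    by (auto simp: D_def G_def)
  have D_sub: "D n U \<subseteq> U" for n U
  proof
    fix p assume "p \<in> D n U"
    then obtain y where "y \<in> M" "mball y (3/2^n) \<subseteq> U" "d y p < 1/2^n" "p \<in> M"
      using D_mem by blast
    moreover have "(1::real)/2^n \<le> 3/2^n" by (simp add: divide_right_mono)
    ultimately have "p \<in> mball y (3/2^n)" by simp
    then show "p \<in> U" using \<open>mball y (3/2^n) \<subseteq> U\<close> by blast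
  qed
  have pow_small: "\<exists>n. (c::real)/2^n < e" if ec: "e > 0" "c > 0" for e c
  proof -
    have "\<exists>n. (1/2)^n < e/c" using ec by (intro real_arch_pow_inv) auto
    then show ?thesis using ec by (auto simp: field_simps power_divide)
  qed
  have D_cov: "\<exists>n. \<exists>U\<in>\<C>. x \<in> D n U" if x: "x \<in> M" for x
  proof -
    have "openin mtopology (first x)" using first(1) opC x by blast
    then obtain e where e: "e > 0" "mball x e \<subseteq> first x"
      using first(2)[OF x] by (auto simp: openin_mtopology)
    \<comment> \<open>A level this fine makes \<open>x\<close> itself a centre, unless an earlier
      level has covered it.\<close>
    obtain n where n: "3/2^n < e" using pow_small[OF e(1), of 3] by auto
    show ?thesis
    proof (cases "x \<in> E n")
      case True then show ?thesis by (auto simp: E_eq)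
    next
      case False
      have "mball x (3/2^n) \<subseteq> first x"
        using e n mball_subset_concentric[of "3/2^n" e x] by auto
      then have "x \<in> A (E n) n (first x)" using False x by (simp add: A_def)
      then have "x \<in> D n (first x)" using x by (auto simp: D_def G_def)
      then show ?thesis using first(1) x by blast
    qed
  qed
  define \<V> where "\<V> = {D n U | n U. U \<in> \<C>}"
  have "\<exists>V. openin mtopology V \<and> x \<in> V \<and> finite {W \<in> \<V>. W \<inter> V \<noteq> {}}" if x: "x \<in> M" for x
  proof -
    obtain n U0 where U0: "U0 \<in> \<C>" "x \<in> D n U0" using D_cov x by blast
    obtain e where e: "e > 0" "mball x e \<subseteq> D n U0"
      using D_open[of n U0] U0 by (auto simp: openin_mtopology)
    obtain k where "1/2^k < e" using pow_small[OF e(1), of 1] by auto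
    then have k: "mball x (1/2^k) \<subseteq> D n U0"
      using e mball_subset_concentric[of "1/2^k" e x] by auto
    \<comment> \<open>The radius \<open>1/2^N\<close> serves twice. From level \<open>N\<close> on,
      centres avoid \<open>D n U0\<close> because \<open>n < N\<close>, so they are at least
      \<open>1/2^k\<close> away from \<open>x\<close>, too far for their balls to reach
      \<open>B\<close>. Below level \<open>N\<close>, \<open>B\<close> is too small to bridge the
      gap between two sets of one level.\<close>
    define N where "N = n + k + 1"
    define B where "B = mball x (1/2^N)"
    have far: "i < N" if meet: "D i U \<inter> B \<noteq> {}" for i U
    proof (rule ccontr)
      assume "\<not> i < N"
      then have i: "i \<ge> N" by simp
      obtain p where p: "p \<in> D i U" "d x p < 1/2^N" using meet by (auto simp: B_def)
      obtain y where y: "y \<in> M" "y \<notin> E i" "d y p < 1/2^i" "p \<in> M" using D_mem[OF p(1)] by blast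
      have "y \<notin> D n U0" using y(2) i U0 by (auto simp: E_eq N_def)
      then have "1/2^k \<le> d x y" using k x y by (meson in_mball linorder_not_less subsetD)
      also have "\<dots> \<le> d x p + d y p" using triangle[OF x y(4) y(1)] commute by metis
      also have "\<dots> < 1/2^N + 1/2^i" using p y by simp
      also have "\<dots> \<le> 1/2^(k+1) + 1/2^(k+1)"
        using i by (intro add_mono divide_left_mono power_increasing) (auto simp: N_def)
      also have "\<dots> = 1/2^k" by simp
      finally show False by simp
    qed
    have sep: "U = U'" if meet: "D i U \<inter> B \<noteq> {}" "D i U' \<inter> B \<noteq> {}" and U: "U \<in> \<C>" "U' \<in> \<C>" for i U U'
    proof -
      have i: "i < N" using far meet by blast
      have main: False if meet: "D i U \<inter> B \<noteq> {}" "D i U' \<inter> B \<noteq> {}" and U: "U \<in> \<C>" "(U, U') \<in> r" "U \<noteq> U'" for U U'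
      proof -
        obtain p where p: "p \<in> D i U" "d x p < 1/2^N" using meet by (auto simp: B_def)
        obtain q where q: "q \<in> D i U'" "d x q < 1/2^N" using meet by (auto simp: B_def)
        obtain y where y: "y \<in> M" "mball y (3/2^i) \<subseteq> U" "d y p < 1/2^i" "p \<in> M"
          using D_mem[OF p(1)] by blast
        obtain z where z: "z \<in> M" "first z = U'" "d z q < 1/2^i" "q \<in> M"
          using D_mem[OF q(1)] by blast
        have "z \<notin> U" using first(3)[of z U] z U by auto
        then have "3/2^i \<le> d y z" using y z by (meson in_mball linorder_not_less subsetD)
        moreover have "d y z \<le> d y p + d x p + d x q + d z q"
          using triangle[OF y(1) y(4) z(1)] triangle[OF y(4) x z(1)] triangle[OF x z(4) z(1)]
            commute[of p x] commute[of q z] by linarith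
        moreover have "(1::real)/2^N \<le> 1/2^(i+1)"
          using i by (intro divide_left_mono power_increasing) auto
        then have "(1::real)/2^N \<le> 1/2 * (1/2^i)" by simp
        moreover have "(3::real)/2^i = 3 * (1/2^i)" by simp
        ultimately show False using p(2) q(2) y(3) z(3) by linarith
      qed
      have "(U, U') \<in> r \<or> (U', U) \<in> r \<or> U = U'" using tot r(2) by (auto simp: total_on_def)
      then show ?thesis using main meet U by blast
    qed
    \<comment> \<open>By \<open>far\<close> and \<open>sep\<close>, \<open>B\<close> meets at most
      one set on each of finitely many levels; \<open>g\<close> picks it.\<close>
    define g where "g i = (SOME U. U \<in> \<C> \<and> D i U \<inter> B \<noteq> {})" for i
    have "D i U \<in> (\<lambda>i. D i (g i)) ` {..<N}" if "U \<in> \<C>" "D i U \<inter> B \<noteq> {}" for i U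
    proof -
      have "g i \<in> \<C> \<and> D i (g i) \<inter> B \<noteq> {}" unfolding g_def using that by (intro someI) auto
      then have "g i = U" using sep that by blast
      then show ?thesis using far that by blast
    qed
    then have "{W \<in> \<V>. W \<inter> B \<noteq> {}} \<subseteq> (\<lambda>i. D i (g i)) ` {..<N}" unfolding \<V>_def by blast
    then have "finite {W \<in> \<V>. W \<inter> B \<noteq> {}}" using finite_surj by blast
    moreover have "openin mtopology B" "x \<in> B" using x by (auto simp: B_def)
    ultimately show ?thesis by blast
  qed
  moreover have "\<Union>\<V> = M"
    using D_cov D_open openin_subset by (fastforce simp: \<V>_def)
  ultimately have "locally_finite_in mtopology \<V>" by (simp add: locally_finite_in_def)
  moreover have "\<forall>W\<in>\<V>. openin mtopology W \<and> (\<exists>U\<in>\<C>. W \<subseteq> U)"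
  proof
    fix W assume "W \<in> \<V>"
    then obtain n U where "W = D n U" "U \<in> \<C>" by (auto simp: \<V>_def)
    then show "openin mtopology W \<and> (\<exists>U\<in>\<C>. W \<subseteq> U)" using D_open D_sub[of n U] by auto
  qed
  ultimately show ?thesis using \<open>\<Union>\<V> = M\<close> by (intro exI[of _ \<V>] conjI)
qed

section \<open>Compact sets, open neighbourhoods and locally finite families\<close>

text \<open>A Lebesgue number argument: finitely many balls of radius \<open>r x\<close> cover
  \<open>K\<close> while the balls of radius \<open>2 * r x\<close> stay in \<open>W\<close>, so the
  least of these finitely many radii works at every point of \<open>K\<close>.\<close>

lemma (in Metric_space) compactin_uniform_enlargement:
  assumes K: "compactin mtopology K" and W: "openin mtopology W" "K \<subseteq> W"
  obtains e where "e > 0" "\<And>x. x \<in> K \<Longrightarrow> mball x e \<subseteq> W"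
proof -
  have KM: "K \<subseteq> M" using K compactin_subset_topspace by fastforce
  have "\<exists>r>0. mball x (2*r) \<subseteq> W" if x: "x \<in> K" for x
  proof -
    obtain s where "s > 0" "mball x s \<subseteq> W" using W x by (auto simp: openin_mtopology)
    then show ?thesis by (intro exI[of _ "s/2"]) auto
  qed
  then obtain r where r: "\<And>x. x \<in> K \<Longrightarrow> r x > 0" "\<And>x. x \<in> K \<Longrightarrow> mball x (2 * r x) \<subseteq> W"
    by metis
  have "\<exists>\<F>. finite \<F> \<and> \<F> \<subseteq> (\<lambda>x. mball x (r x)) ` K \<and> K \<subseteq> \<Union>\<F>"
    by (rule compactinD[OF K]) (use r KM in auto)
  then obtain \<F> where \<F>: "finite \<F>" "\<F> \<subseteq> (\<lambda>x. mball x (r x)) ` K" "K \<subseteq> \<Union>\<F>"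
    by (elim exE conjE)
  then obtain F where F: "finite F" "F \<subseteq> K" "K \<subseteq> (\<Union>x\<in>F. mball x (r x))"
    using finite_subset_image[OF \<F>(1,2)] by auto
  \<comment> \<open>The extra \<open>1\<close> keeps \<open>Min\<close> meaningful when
    \<open>F\<close> is empty.\<close>
  define e where "e = Min (insert 1 (r ` F))"
  have e: "e \<le> r x" if "x \<in> F" for x using F that by (simp add: e_def)
  show thesis
  proof
    show "e > 0" using F r by (auto simp: e_def)
    fix y assume "y \<in> K"
    then obtain x where x: "x \<in> F" "y \<in> mball x (r x)" using F by blast
    have "mball y e \<subseteq> mball x (2 * r x)"
    proof
      fix z assume "z \<in> mball y e"
      then show "z \<in> mball x (2 * r x)" using x e[OF x(1)] triangle[of x y z] by auto
    qed
    then show "mball y e \<subseteq> W" using r F x by blast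
  qed
qed

text \<open>Finitely many neighbourhoods, each meeting finitely many members, cover
  \<open>K\<close>. Applied to a fibre, this bounds the number of image sets through a
  point.\<close>

lemma compactin_locally_finite_in:
  assumes K: "compactin X K" and A: "locally_finite_in X \<A>"
  shows "finite {U \<in> \<A>. U \<inter> K \<noteq> {}}"
proof -
  have "K \<subseteq> topspace X" using K compactin_subset_topspace by blast
  then have "\<forall>x\<in>K. \<exists>V. openin X V \<and> x \<in> V \<and> finite {U \<in> \<A>. U \<inter> V \<noteq> {}}"
    using A unfolding locally_finite_in_def by blast
  then obtain V where V: "\<And>x. x \<in> K \<Longrightarrow> openin X (V x)" "\<And>x. x \<in> K \<Longrightarrow> x \<in> V x"
      "\<And>x. x \<in> K \<Longrightarrow> finite {U \<in> \<A>. U \<inter> V x \<noteq> {}}"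
    by (auto dest!: bchoice)
  have "\<exists>\<F>. finite \<F> \<and> \<F> \<subseteq> V ` K \<and> K \<subseteq> \<Union>\<F>"
    by (rule compactinD[OF K]) (use V in auto)
  then obtain \<F> where \<F>: "finite \<F>" "\<F> \<subseteq> V ` K" "K \<subseteq> \<Union>\<F>"
    by (elim exE conjE)
  then obtain F where F: "finite F" "F \<subseteq> K" "K \<subseteq> \<Union>(V ` F)"
    using finite_subset_image[OF \<F>(1,2)] by auto
  have "finite (\<Union>x\<in>F. {U \<in> \<A>. U \<inter> V x \<noteq> {}})"
    using F(1,2) V(3) by (intro finite_UN_I) auto
  moreover have "U \<in> (\<Union>x\<in>F. {U \<in> \<A>. U \<inter> V x \<noteq> {}})" if U: "U \<in> \<A>" "U \<inter> K \<noteq> {}" for U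
  proof -
    obtain y where "y \<in> U" "y \<in> K" using U(2) by blast
    moreover then obtain x where "x \<in> F" "y \<in> V x" using F(3) by auto
    ultimately show ?thesis using U(1) by auto
  qed
  ultimately show ?thesis by (elim rev_finite_subset) auto
qed

section \<open>Non-isolated points and developments\<close>

text \<open>A second point exists because \<open>{x}\<close> is not open, and deleting it preserves
  openness because points are closed. The result is a neighbourhood of \<open>x\<close> that
  includes no superset of \<open>U\<close>.\<close>

lemma non_isolated_punctured:
  assumes "t1_space X" "x \<in> non_isolated X" "openin X U" "x \<in> U"
  obtains y where "y \<in> U" "y \<noteq> x" "openin X (U - {y})"
proof -
  have "U \<noteq> {x}" using assms by (auto simp: non_isolated_def)
  then obtain y where "y \<in> U" "y \<noteq> x" using assms by blast
  then show thesis using that assms t1_space_openin_delete_alt by metis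
qed

lemma neighborhood_base_of_point_openI:
  assumes "\<And>V. V \<in> \<B> \<Longrightarrow> openin X V \<and> x \<in> V"
    and "\<And>U. \<lbrakk>openin X U; x \<in> U\<rbrakk> \<Longrightarrow> \<exists>V\<in>\<B>. V \<subseteq> U"
  shows "neighborhood_base_of_point X x \<B>"
  using assms by (auto simp: neighborhood_base_of_point_def interior_of_openin dest: openin_subset)

text \<open>A star lies in \<open>U\<close> exactly if each member through \<open>x\<close> does, so
  the star condition becomes one on single members. The covering premise keeps stars from being
  empty.\<close>

lemma point_finite_developmentI:
  assumes "\<And>n P. P \<in> \<P> n \<Longrightarrow> openin X P"
    and "\<And>n x. x \<in> non_isolated X \<Longrightarrow> finite (family_at (\<P> n) x)"
    and "\<And>n x. x \<in> non_isolated X \<Longrightarrow> \<exists>P\<in>\<P> n. x \<in> P"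
    and "\<And>x U. \<lbrakk>x \<in> non_isolated X; openin X U; x \<in> U\<rbrakk>
           \<Longrightarrow> \<exists>n. \<forall>P\<in>\<P> n. x \<in> P \<longrightarrow> P \<subseteq> U"
  shows "point_finite_development_at_non_isolated X \<P>"
  unfolding point_finite_development_at_non_isolated_def development_at_non_isolated_def
proof (intro conjI allI ballI)
  fix x assume x: "x \<in> non_isolated X"
  show "neighborhood_base_of_point X x (range (\<lambda>n. star_at x (\<P> n)))"
  proof (rule neighborhood_base_of_point_openI)
    fix V assume "V \<in> range (\<lambda>n. star_at x (\<P> n))"
    then show "openin X V \<and> x \<in> V"
      using assms(1) assms(3)[OF x] by (force simp: star_at_def family_at_def)
  next
    fix U assume "openin X U" "x \<in> U"
    then show "\<exists>V\<in>range (\<lambda>n. star_at x (\<P> n)). V \<subseteq> U"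
      using assms(4)[OF x] by (force simp: star_at_def family_at_def)
  qed
qed (use assms in auto)

text \<open>Every star is a neighbourhood of \<open>x\<close> and so contains \<open>x\<close>;
  hence each family covers the non-isolated points.\<close>

lemma point_finite_developmentD:
  assumes "point_finite_development_at_non_isolated X \<P>"
  shows "P \<in> \<P> n \<Longrightarrow> openin X P"
    and "x \<in> non_isolated X \<Longrightarrow> finite (family_at (\<P> n) x)"
    and "x \<in> non_isolated X \<Longrightarrow> \<exists>P\<in>\<P> n. x \<in> P"
    and "\<lbrakk>x \<in> non_isolated X; openin X U; x \<in> U\<rbrakk> \<Longrightarrow> \<exists>n. \<forall>P\<in>\<P> n. x \<in> P \<longrightarrow> P \<subseteq> U"
proof -
  show "P \<in> \<P> n \<Longrightarrow> openin X P" "x \<in> non_isolated X \<Longrightarrow> finite (family_at (\<P> n) x)"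
    using assms by (auto simp: point_finite_development_at_non_isolated_def development_at_non_isolated_def)
  have nb: "neighborhood_base_of_point X x (range (\<lambda>n. star_at x (\<P> n)))" if "x \<in> non_isolated X"
    using assms that by (auto simp: point_finite_development_at_non_isolated_def development_at_non_isolated_def)
  show "\<exists>P\<in>\<P> n. x \<in> P" if "x \<in> non_isolated X"
  proof -
    have "x \<in> star_at x (\<P> n)"
      using nb[OF that] interior_of_subset by (fastforce simp: neighborhood_base_of_point_def)
    then show ?thesis by (auto simp: star_at_def family_at_def)
  qed
  show "\<exists>n. \<forall>P\<in>\<P> n. x \<in> P \<longrightarrow> P \<subseteq> U" if "x \<in> non_isolated X" "openin X U" "x \<in> U"
  proof -
    have "\<exists>V\<in>range (\<lambda>n. star_at x (\<P> n)). V \<subseteq> U"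
      using nb[OF that(1)] that(2,3) unfolding neighborhood_base_of_point_def by blast
    then obtain n where "star_at x (\<P> n) \<subseteq> U" by blast
    then show ?thesis by (auto simp: star_at_def family_at_def)
  qed
qed

section \<open>Uniform and point-regular bases\<close>

text \<open>Infinitely many members not inside \<open>U\<close> would include a countably infinite
  family with no member inside \<open>U\<close>. Conversely, an infinite family of members through
  \<open>x\<close> cannot consist of the finitely many exceptions alone.\<close>

lemma uniform_base_iff_point_regular_base:
  "uniform_base_at_non_isolated X \<P> \<longleftrightarrow> point_regular_base_at_non_isolated X \<P>"
proof
  assume L: "uniform_base_at_non_isolated X \<P>"
  have "finite {P \<in> family_at \<P> x. \<not> P \<subseteq> U}"
    if x: "x \<in> non_isolated X" and U: "openin X U" "x \<in> U" for x U
  proof (rule ccontr)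
    assume "\<not> ?thesis"
    then obtain \<Q> where Q: "\<Q> \<subseteq> {P \<in> family_at \<P> x. \<not> P \<subseteq> U}" "countable \<Q>" "infinite \<Q>"
      using infinite_countable_subset' by blast
    then have "neighborhood_base_of_point X x \<Q>"
      using L x unfolding uniform_base_at_non_isolated_def by blast
    then obtain V where "V \<in> \<Q>" "V \<subseteq> U" using U unfolding neighborhood_base_of_point_def by blast
    then show False using Q by blast
  qed
  then show "point_regular_base_at_non_isolated X \<P>"
    using L unfolding point_regular_base_at_non_isolated_def uniform_base_at_non_isolated_def by blast
next
  assume R: "point_regular_base_at_non_isolated X \<P>"
  have "neighborhood_base_of_point X x \<Q>"
    if x: "x \<in> non_isolated X" and Q: "\<Q> \<subseteq> family_at \<P> x" "infinite \<Q>" for x \<Q>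
  proof (rule neighborhood_base_of_point_openI)
    show "openin X V \<and> x \<in> V" if "V \<in> \<Q>" for V
      using that Q R
      unfolding point_regular_base_at_non_isolated_def base_of_space_def family_at_def by blast
    fix U assume "openin X U" "x \<in> U"
    then have "finite {P \<in> family_at \<P> x. \<not> P \<subseteq> U}"
      using R x unfolding point_regular_base_at_non_isolated_def by blast
    then have "\<not> \<Q> \<subseteq> {P \<in> family_at \<P> x. \<not> P \<subseteq> U}" using Q(2) finite_subset by blast
    then show "\<exists>V\<in>\<Q>. V \<subseteq> U" using Q(1) by blast
  qed
  then show "uniform_base_at_non_isolated X \<P>"
    using R unfolding point_regular_base_at_non_isolated_def uniform_base_at_non_isolated_def by blast
qed

section \<open>From open boundary-compact maps to developments\<close>

text \<open>A nonempty open set inside the fibre would have the open image \<open>{x}\<close>. So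
  the closed fibre has empty interior and equals its own boundary.\<close>

lemma compactin_fibre_non_isolated:
  assumes H: "Hausdorff_space X" and f: "open_boundary_compact_surjection Y X f"
    and x: "x \<in> non_isolated X"
  shows "compactin Y {y \<in> topspace Y. f y = x}" (is "compactin Y ?F")
proof -
  have xX: "x \<in> topspace X" and cont: "continuous_map Y X f" and op: "open_map Y X f"
    and cpt: "compactin Y (Y frontier_of ?F)"
    using x f by (auto simp: non_isolated_def open_boundary_compact_surjection_def boundary_compact_map_def)
  have "closedin Y ?F"
    using closedin_continuous_map_preimage[OF cont closedin_Hausdorff_singleton[OF H xX]] by simp
  moreover have "Y interior_of ?F = {}"
    unfolding interior_of_eq_empty
  proof (intro allI impI)
    fix T assume T: "openin Y T \<and> T \<subseteq> ?F"
    show "T = {}"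
    proof (rule ccontr)
      assume "T \<noteq> {}"
      then have "f ` T = {x}" using T by auto
      moreover have "openin X (f ` T)" using op T unfolding open_map_def by blast
      ultimately show False using x by (simp add: non_isolated_def)
    qed
  qed
  ultimately have "Y frontier_of ?F = ?F" by (simp add: frontier_of_def closure_of_closedin)
  then show ?thesis using cpt by simp
qed

text \<open>Compactness of the fibre acts twice: only finitely many members of a locally finite
  cover meet it, and those that meet it, once small, stay in the preimage of
  \<open>U\<close>.\<close>

lemma open_boundary_compact_image_imp_development:
  assumes H: "Hausdorff_space X" and im: "open_boundary_compact_image_of_metric TYPE('m) X"
  shows "\<exists>\<P>. point_finite_development_at_non_isolated X \<P>"
proof -
  obtain m :: "'m metric" and f where f: "open_boundary_compact_surjection (mtopology_of m) X f"
    using im unfolding open_boundary_compact_image_of_metric_def by (elim exE)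
  interpret Metric_space "mspace m" "mdist m" by simp
  have top: "mtopology_of m = mtopology" by (simp add: mtopology_of_def)
  have cont: "continuous_map mtopology X f" and surj: "f ` mspace m = topspace X"
    and op: "open_map mtopology X f"
    using f by (auto simp: open_boundary_compact_surjection_def top)
  have "\<exists>\<V>. (\<forall>D\<in>\<V>. openin mtopology D) \<and> \<Union>\<V> = mspace m \<and>
          (\<forall>D\<in>\<V>. \<exists>c. D \<subseteq> mball c (1 / real (Suc n))) \<and> locally_finite_in mtopology \<V>" for n
  proof -
    let ?\<C> = "(\<lambda>c. mball c (1 / real (Suc n))) ` mspace m"
    have cov: "mspace m \<subseteq> \<Union>?\<C>" by auto
    have opn: "\<forall>U\<in>?\<C>. openin mtopology U" by blast
    obtain \<V> where V: "\<forall>D\<in>\<V>. openin mtopology D \<and> (\<exists>U\<in>?\<C>. D \<subseteq> U)"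
        "\<Union>\<V> = mspace m" "locally_finite_in mtopology \<V>"
      using locally_finite_open_refinement[OF opn cov] by (elim exE conjE)
    have "\<exists>c. D \<subseteq> mball c (1 / real (Suc n))" if "D \<in> \<V>" for D
      using bspec[OF V(1) that] by blast
    then show ?thesis using V by (intro exI[of _ \<V>]) simp
  qed
  then obtain \<V> where V: "\<And>n D. D \<in> \<V> n \<Longrightarrow> openin mtopology D" "\<And>n. \<Union>(\<V> n) = mspace m"
      "\<And>n D. D \<in> \<V> n \<Longrightarrow> \<exists>c. D \<subseteq> mball c (1 / real (Suc n))"
      "\<And>n. locally_finite_in mtopology (\<V> n)"
    by metis
  have "point_finite_development_at_non_isolated X (\<lambda>n. (`) f ` \<V> n)"
  proof (rule point_finite_developmentI)
    show "openin X P" if "P \<in> (`) f ` \<V> n" for n P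
      using that V(1) op by (auto simp: open_map_def)
    show "\<exists>P\<in>(`) f ` \<V> n. x \<in> P" if "x \<in> non_isolated X" for n x
    proof -
      have "x \<in> f ` mspace m" using that surj by (simp add: non_isolated_def)
      then obtain y where "y \<in> mspace m" "f y = x" by blast
      moreover then obtain D where "D \<in> \<V> n" "y \<in> D" using V(2) by blast
      ultimately show ?thesis by blast
    qed
  next
    fix n x assume x: "x \<in> non_isolated X"
    define K where "K = {y \<in> mspace m. f y = x}"
    have "compactin mtopology K"
      using compactin_fibre_non_isolated[OF H f x] by (simp add: K_def top)
    then have "finite {D \<in> \<V> n. D \<inter> K \<noteq> {}}"
      using compactin_locally_finite_in V(4) by blast
    moreover have "family_at ((`) f ` \<V> n) x \<subseteq> (`) f ` {D \<in> \<V> n. D \<inter> K \<noteq> {}}"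
      using V(2) by (fastforce simp: family_at_def K_def)
    ultimately show "finite (family_at ((`) f ` \<V> n) x)" using finite_surj by blast
  next
    fix x U assume x: "x \<in> non_isolated X" and U: "openin X U" "x \<in> U"
    define K where "K = {y \<in> mspace m. f y = x}"
    define W where "W = {y \<in> mspace m. f y \<in> U}"
    have K: "compactin mtopology K"
      using compactin_fibre_non_isolated[OF H f x] by (simp add: K_def top)
    have W: "openin mtopology W" "K \<subseteq> W"
      using openin_continuous_map_preimage[OF cont U(1)] U by (auto simp: K_def W_def)
    obtain e where e: "e > 0" "\<And>x. x \<in> K \<Longrightarrow> mball x e \<subseteq> W"
      using compactin_uniform_enlargement[OF K W] by blast
    \<comment> \<open>A set inside a ball of radius below \<open>e / 2\<close> that meets
      \<open>K\<close> at \<open>y\<close> stays within \<open>mball y e\<close>.\<close>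
    obtain n where n: "1 / real (Suc n) < e / 2" using e nat_approx_posE half_gt_zero by metis
    have "P \<subseteq> U" if P: "P \<in> (`) f ` \<V> n" "x \<in> P" for P
    proof -
      obtain D where D: "D \<in> \<V> n" "P = f ` D" using P by blast
      obtain y where y: "y \<in> D" "y \<in> K" using P D V(2) by (fastforce simp: K_def)
      obtain c where c: "D \<subseteq> mball c (1 / real (Suc n))" using V(3) D by blast
      have "z \<in> mball y e" if "z \<in> D" for z
      proof -
        have "c \<in> mspace m" "z \<in> mspace m" "y \<in> mspace m" "mdist m c z < 1 / real (Suc n)" "mdist m c y < 1 / real (Suc n)"
          using c y that in_mball by blast+
        then show ?thesis using triangle[of y c z] commute[of c y] n by simp
      qed
      then have "D \<subseteq> W" using e y by blast
      then show ?thesis using D by (auto simp: W_def)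
    qed
    then show "\<exists>n. \<forall>P\<in>(`) f ` \<V> n. x \<in> P \<longrightarrow> P \<subseteq> U" by blast
  qed
  then show ?thesis by blast
qed

section \<open>Point-regular bases and developments\<close>

text \<open>Distinct maximal members are incomparable, so the members of \<open>\<P> n\<close>
  through \<open>x\<close> other than a chosen \<open>B\<close> are among the finitely many not
  inside \<open>B\<close>. Counting supersets forces smallness: the finitely many base members
  through \<open>x\<close> not inside \<open>U\<close> have bounded counts, so they drop out of
  \<open>L n\<close> for large \<open>n\<close>.\<close>

lemma point_regular_base_imp_development:
  assumes t1: "t1_space X" and R: "point_regular_base_at_non_isolated X \<B>"
  shows "\<exists>\<P>. point_finite_development_at_non_isolated X \<P>"
proof -
  have opB: "\<And>B. B \<in> \<B> \<Longrightarrow> openin X B"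
    and base: "\<And>U x. \<lbrakk>openin X U; x \<in> U\<rbrakk> \<Longrightarrow> \<exists>B\<in>\<B>. x \<in> B \<and> B \<subseteq> U"
    and reg: "\<And>x U. \<lbrakk>x \<in> non_isolated X; openin X U; x \<in> U\<rbrakk> \<Longrightarrow> finite {B \<in> \<B>. x \<in> B \<and> \<not> B \<subseteq> U}"
    using R by (auto simp: point_regular_base_at_non_isolated_def base_of_space_def family_at_def)
  define above where "above B = {V \<in> \<B>. B \<subseteq> V}" for B
  \<comment> \<open>Meeting \<open>non_isolated X\<close> makes \<open>above B\<close> finite by
    \<open>fin_above\<close>, so that \<open>card\<close>, which is \<open>0\<close> on infinite
    sets, really counts.\<close>
  define L where "L n = {B \<in> \<B>. B \<inter> non_isolated X \<noteq> {} \<and> card (above B) \<ge> n}" for n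
  define \<P> where "\<P> n = {B \<in> L n. \<forall>V\<in>L n. B \<subseteq> V \<longrightarrow> V = B}" for n
  \<comment> \<open>A superset of \<open>B\<close> contains \<open>y\<close>, so it is not inside the neighbourhood \<open>B - {y}\<close> of \<open>x\<close>.\<close>
  have fin_above: "finite (above B)" if x: "x \<in> non_isolated X" "x \<in> B" "B \<in> \<B>" for x B
  proof -
    obtain y where y: "y \<in> B" "y \<noteq> x" "openin X (B - {y})"
      using non_isolated_punctured[OF t1 x(1) opB[OF x(3)] x(2)] by blast
    have "above B \<subseteq> {V \<in> \<B>. x \<in> V \<and> \<not> V \<subseteq> B - {y}}" using x y by (auto simp: above_def)
    moreover have "finite \<dots>" using reg[OF x(1) y(3)] x y by auto
    ultimately show ?thesis using finite_subset by blast
  qed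
  \<comment> \<open>Otherwise the intersection of all members through \<open>x\<close> would be the
    least open neighbourhood of \<open>x\<close>, yet removing \<open>y\<close> leaves a smaller
    one.\<close>
  have inf: "infinite {B \<in> \<B>. x \<in> B}" if x: "x \<in> non_isolated X" for x
  proof
    assume fin: "finite {B \<in> \<B>. x \<in> B}"
    have xX: "x \<in> topspace X" using x by (simp add: non_isolated_def)
    let ?W = "topspace X \<inter> \<Inter>{B \<in> \<B>. x \<in> B}"
    have "openin X ?W"
    proof (cases "{B \<in> \<B>. x \<in> B} = {}")
      case False then show ?thesis using fin opB by (intro openin_Int openin_Inter) auto
    qed (simp only: Inter_empty Int_UNIV_right openin_topspace)
    then obtain y where y: "y \<in> ?W" "y \<noteq> x" "openin X (?W - {y})"
      using non_isolated_punctured[OF t1 x] xX by blast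
    then obtain B where "B \<in> \<B>" "x \<in> B" "B \<subseteq> ?W - {y}" using base[OF y(3), of x] xX by blast
    then show False using y(1) by blast
  qed
  have L_cov: "\<exists>B\<in>L n. x \<in> B" if x: "x \<in> non_isolated X" for x n
  proof -
    obtain \<F> where F: "\<F> \<subseteq> {B \<in> \<B>. x \<in> B}" "finite \<F>" "card \<F> = n"
      using infinite_arbitrarily_large[OF inf[OF x]] by blast
    have xX: "x \<in> topspace X" using x by (simp add: non_isolated_def)
    let ?W = "topspace X \<inter> \<Inter>\<F>"
    have "openin X ?W"
    proof (cases "\<F> = {}")
      case False then show ?thesis using F opB by (intro openin_Int openin_Inter) auto
    qed (simp only: Inter_empty Int_UNIV_right openin_topspace)
    then obtain B where B: "B \<in> \<B>" "x \<in> B" "B \<subseteq> ?W" using base[of ?W x] xX F(1) by blast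
    have "\<F> \<subseteq> above B" using B F(1) by (auto simp: above_def)
    then have "n \<le> card (above B)" using F(3) card_mono[OF fin_above[OF x B(2,1)]] by blast
    then show ?thesis using B x by (auto simp: L_def)
  qed
  have P_cov: "\<exists>B\<in>\<P> n. x \<in> B" if x: "x \<in> non_isolated X" for x n
  proof -
    obtain B where B: "B \<in> L n" "x \<in> B" using L_cov[OF x] by blast
    then have "finite (above B)" using fin_above x by (auto simp: L_def)
    then have "finite {V \<in> L n. B \<subseteq> V}"
      by (rule rev_finite_subset) (auto simp: above_def L_def)
    from finite_has_maximal2[OF this, of B]
    obtain V where V: "V \<in> L n" "B \<subseteq> V" "\<forall>W\<in>{V \<in> L n. B \<subseteq> V}. V \<subseteq> W \<longrightarrow> V = W"
      using B by blast
    \<comment> \<open>Maximality above \<open>B\<close> is maximality in \<open>L n\<close>, since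
      whatever contains \<open>V\<close> contains \<open>B\<close>.\<close>
    then have "V \<in> \<P> n" unfolding \<P>_def by blast
    then show ?thesis using V B by blast
  qed
  have P_B: "\<P> n \<subseteq> \<B>" for n by (auto simp: \<P>_def L_def)
  have "point_finite_development_at_non_isolated X \<P>"
  proof (rule point_finite_developmentI)
    fix n x assume x: "x \<in> non_isolated X"
    obtain B where B: "B \<in> \<P> n" "x \<in> B" using P_cov[OF x] by blast
    have "family_at (\<P> n) x \<subseteq> insert B {V \<in> \<B>. x \<in> V \<and> \<not> V \<subseteq> B}"
      using B P_B by (auto simp: family_at_def \<P>_def)
    moreover have "finite {V \<in> \<B>. x \<in> V \<and> \<not> V \<subseteq> B}" using reg[OF x opB] B P_B by blast
    ultimately show "finite (family_at (\<P> n) x)" using finite_subset by blast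
  next
    fix x U assume x: "x \<in> non_isolated X" and U: "openin X U" "x \<in> U"
    let ?F = "{B \<in> \<B>. x \<in> B \<and> \<not> B \<subseteq> U}"
    have "finite ((\<lambda>B. card (above B)) ` ?F)" using reg[OF x U] by simp
    then obtain N where N: "\<forall>k\<in>(\<lambda>B. card (above B)) ` ?F. k < N"
      using finite_nat_set_iff_bounded by blast
    have "\<forall>P\<in>\<P> N. x \<in> P \<longrightarrow> P \<subseteq> U"
    proof (intro ballI impI, rule ccontr)
      fix P assume P: "P \<in> \<P> N" "x \<in> P" "\<not> P \<subseteq> U"
      then have "card (above P) < N" using N P_B by blast
      then show False using P by (simp add: \<P>_def L_def)
    qed
    then show "\<exists>n. \<forall>P\<in>\<P> n. x \<in> P \<longrightarrow> P \<subseteq> U" by blast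
  qed (use opB P_B P_cov in blast)+
  then show ?thesis by blast
qed

text \<open>Intersecting the first levels makes smallness persist: once the members of
  \<open>\<P> n\<close> through \<open>x\<close> lie in \<open>U\<close>, so do those of every
  \<open>Q m\<close> with \<open>m \<ge> n\<close>. Exceptions come only from the finitely many
  levels below \<open>n\<close>, each point-finite.\<close>

lemma development_imp_point_regular_base:
  assumes D: "point_finite_development_at_non_isolated X \<P>"
  shows "\<exists>\<B>. point_regular_base_at_non_isolated X \<B>"
proof -
  note opP = point_finite_developmentD(1)[OF D] and finP = point_finite_developmentD(2)[OF D]
    and covP = point_finite_developmentD(3)[OF D] and nbP = point_finite_developmentD(4)[OF D]
  \<comment> \<open>The index \<open>0\<close> is always present, so each intersection runs over a
    nonempty finite family and is open.\<close>
  define Q where "Q n = {(\<Inter>i\<le>n. \<alpha> i) | \<alpha>. \<forall>i\<le>n. \<alpha> i \<in> \<P> i}" for n :: nat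
  \<comment> \<open>The open singletons supply the base at isolated points and contain no
    non-isolated point.\<close>
  define \<B> where "\<B> = (\<Union>n. Q n) \<union> {{x} | x. openin X {x}}"
  have opQ: "openin X B" if "B \<in> Q n" for B n
    using that opP by (auto simp: Q_def intro!: openin_Inter)
  have finQ: "finite {B \<in> Q n. x \<in> B}" if x: "x \<in> non_isolated X" for x n
  proof -
    have "{B \<in> Q n. x \<in> B} \<subseteq> (\<lambda>\<alpha>. \<Inter>i\<le>n. \<alpha> i) ` (\<Pi>\<^sub>E i\<in>{..n}. family_at (\<P> i) x)"
    proof
      fix B assume "B \<in> {B \<in> Q n. x \<in> B}"
      then obtain \<alpha> where a: "B = (\<Inter>i\<le>n. \<alpha> i)" "\<forall>i\<le>n. \<alpha> i \<in> \<P> i" "x \<in> B"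
        by (auto simp: Q_def)
      then have "restrict \<alpha> {..n} \<in> (\<Pi>\<^sub>E i\<in>{..n}. family_at (\<P> i) x)"
        by (auto simp: family_at_def)
      moreover have "B = (\<Inter>i\<le>n. restrict \<alpha> {..n} i)" using a(1) by simp
      ultimately show "B \<in> (\<lambda>\<alpha>. \<Inter>i\<le>n. \<alpha> i) ` (\<Pi>\<^sub>E i\<in>{..n}. family_at (\<P> i) x)" by blast
    qed
    moreover have "finite (\<Pi>\<^sub>E i\<in>{..n}. family_at (\<P> i) x)" using finP[OF x] by (intro finite_PiE) auto
    ultimately show ?thesis using finite_surj by blast
  qed
  have covQ: "\<exists>B\<in>Q n. x \<in> B" if x: "x \<in> non_isolated X" for x n
  proof -
    obtain \<alpha> where "\<And>i. \<alpha> i \<in> \<P> i \<and> x \<in> \<alpha> i" using covP[OF x] by metis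
    then have "(\<Inter>i\<le>n. \<alpha> i) \<in> Q n" "x \<in> (\<Inter>i\<le>n. \<alpha> i)" unfolding Q_def by blast+
    then show ?thesis by blast
  qed
  have nbQ: "\<exists>n. \<forall>m\<ge>n. \<forall>B\<in>Q m. x \<in> B \<longrightarrow> B \<subseteq> U"
    if x: "x \<in> non_isolated X" "openin X U" "x \<in> U" for x U
  proof -
    obtain n where n: "\<forall>P\<in>\<P> n. x \<in> P \<longrightarrow> P \<subseteq> U" using nbP[OF x] by blast
    have "B \<subseteq> U" if B: "m \<ge> n" "B \<in> Q m" "x \<in> B" for m B
    proof -
      obtain \<alpha> where "B = (\<Inter>i\<le>m. \<alpha> i)" "\<forall>i\<le>m. \<alpha> i \<in> \<P> i" using B by (auto simp: Q_def)
      then have "B \<subseteq> \<alpha> n" "\<alpha> n \<in> \<P> n" using B(1) by auto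
      then show ?thesis using n B(3) by blast
    qed
    then show ?thesis by blast
  qed
  have "base_of_space X \<B>"
    unfolding base_of_space_def
  proof (intro conjI ballI allI impI)
    show "openin X P" if "P \<in> \<B>" for P using that opQ by (auto simp: \<B>_def)
    fix U x assume U: "openin X U \<and> x \<in> U"
    show "\<exists>P\<in>\<B>. x \<in> P \<and> P \<subseteq> U"
    proof (cases "openin X {x}")
      case True
      then have "{x} \<in> \<B>" by (auto simp: \<B>_def)
      then show ?thesis using U by blast
    next
      case False
      then have x: "x \<in> non_isolated X" using U openin_subset by (fastforce simp: non_isolated_def)
      then obtain n where "\<forall>m\<ge>n. \<forall>B\<in>Q m. x \<in> B \<longrightarrow> B \<subseteq> U" using nbQ U by blast
      moreover obtain B where "B \<in> Q n" "x \<in> B" using covQ[OF x] by blast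
      ultimately show ?thesis by (auto simp: \<B>_def)
    qed
  qed
  moreover have "finite {P \<in> family_at \<B> x. \<not> P \<subseteq> U}"
    if x: "x \<in> non_isolated X" "openin X U" "x \<in> U" for x U
  proof -
    obtain n where n: "\<forall>m\<ge>n. \<forall>B\<in>Q m. x \<in> B \<longrightarrow> B \<subseteq> U" using nbQ[OF x] by blast
    have "P \<in> (\<Union>m<n. {B \<in> Q m. x \<in> B})" if P: "P \<in> \<B>" "x \<in> P" "\<not> P \<subseteq> U" for P
    proof -
      have "P \<noteq> {y}" if "openin X {y}" for y using that P x by (auto simp: non_isolated_def)
      then obtain m where m: "P \<in> Q m" using P(1) by (auto simp: \<B>_def)
      then have "m < n" using n P by (meson not_le)
      then show ?thesis using m P by blast
    qed
    then have "{P \<in> family_at \<B> x. \<not> P \<subseteq> U} \<subseteq> (\<Union>m<n. {B \<in> Q m. x \<in> B})"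
      unfolding family_at_def by blast
    moreover have "finite (\<Union>m<n. {B \<in> Q m. x \<in> B})" using finQ[OF x(1)] by blast
    ultimately show ?thesis using finite_subset by blast
  qed
  ultimately show ?thesis unfolding point_regular_base_at_non_isolated_def by blast
qed

section \<open>Ponomarev's space over a point-finite development\<close>

text \<open>A point of the space is a sequence of sets closing in on a point of \<open>X\<close>,
  and \<open>f\<close> reads off that point. Countably many coordinates give metrizability; finitely
  many choices per coordinate over a non-isolated point give compact fibres.\<close>

lemma development_imp_open_boundary_compact_image:
  fixes X :: "'a topology"
  assumes H: "Hausdorff_space X" and D: "point_finite_development_at_non_isolated X \<P>"
  shows "open_boundary_compact_image_of_metric TYPE(nat \<Rightarrow> 'a set) X"
proof -
  note t1 = Hausdorff_imp_t1_space[OF H]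
  note opP = point_finite_developmentD(1)[OF D] and finP = point_finite_developmentD(2)[OF D]
    and covP = point_finite_developmentD(3)[OF D] and nbP = point_finite_developmentD(4)[OF D]
  \<comment> \<open>The singletons make the families cover \<open>X\<close> without changing them at non-isolated points.\<close>
  define Q where "Q n = \<P> n \<union> {{x} | x. openin X {x}}" for n
  have opQ: "openin X B" if "B \<in> Q n" for B n
    using that opP by (auto simp: Q_def)
  have Q_at: "{B \<in> Q n. x \<in> B} = family_at (\<P> n) x" if "x \<in> non_isolated X" for n x
    using that by (auto simp: Q_def family_at_def non_isolated_def)
  \<comment> \<open>Stars arbitrarily far out are small: a point \<open>y\<close> common to the first \<open>N\<close> sets is excluded.\<close>
  have nbP_late: "\<exists>n\<ge>N. \<forall>P\<in>\<P> n. x \<in> P \<longrightarrow> P \<subseteq> U"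
    if x: "x \<in> non_isolated X" and U: "openin X U" "x \<in> U" for x U and N :: nat
  proof -
    obtain \<alpha> where \<alpha>: "\<And>i. \<alpha> i \<in> \<P> i \<and> x \<in> \<alpha> i" using covP[OF x] by metis
    define W where "W = U \<inter> (topspace X \<inter> \<Inter>(\<alpha> ` {..<N}))"
    have "openin X (topspace X \<inter> \<Inter>(\<alpha> ` {..<N}))"
    proof (cases "N = 0")
      case False
      then show ?thesis using \<alpha> opP by (intro openin_Int openin_Inter) auto
    qed simp
    then have "openin X W" using U by (simp add: W_def openin_Int)
    moreover have "x \<in> W" using \<alpha> U x by (auto simp: W_def non_isolated_def)
    ultimately obtain y where y: "y \<in> W" "y \<noteq> x" "openin X (W - {y})"
      using non_isolated_punctured[OF t1 x] by blast
    then obtain n where n: "\<forall>P\<in>\<P> n. x \<in> P \<longrightarrow> P \<subseteq> W - {y}"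
      using nbP[OF x y(3)] \<open>x \<in> W\<close> by blast
    have "n \<ge> N"
    proof (rule ccontr)
      assume "\<not> n \<ge> N"
      then have "y \<in> \<alpha> n" using y(1) by (auto simp: W_def)
      then show False using n \<alpha>[of n] by blast
    qed
    then show ?thesis using n by (auto simp: W_def)
  qed
  \<comment> \<open>The terms from \<open>N\<close> on already close in on \<open>x\<close>, so the
    first \<open>N\<close> terms can later be replaced without losing the point.\<close>
  have extend: "\<exists>\<beta>. (\<forall>n. \<beta> n \<in> Q n \<and> x \<in> \<beta> n) \<and>
      (\<forall>U N. openin X U \<and> x \<in> U \<longrightarrow> (\<exists>n\<ge>N. \<beta> n \<subseteq> U))"
    if x: "x \<in> topspace X" for x
  proof (cases "openin X {x}")
    case True
    then show ?thesis by (intro exI[of _ "\<lambda>n. {x}"]) (auto simp: Q_def)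
  next
    case False
    then have x: "x \<in> non_isolated X" using x by (simp add: non_isolated_def)
    obtain \<beta> where \<beta>: "\<And>i. \<beta> i \<in> \<P> i \<and> x \<in> \<beta> i" using covP[OF x] by metis
    have "\<exists>n\<ge>N. \<beta> n \<subseteq> U" if U: "openin X U" "x \<in> U" for U N
    proof -
      obtain n where "n \<ge> N" "\<forall>P\<in>\<P> n. x \<in> P \<longrightarrow> P \<subseteq> U"
        using nbP_late[OF x U, of N] by (elim exE conjE)
      then show ?thesis using \<beta>[of n] by (intro exI[of _ n]) simp
    qed
    then show ?thesis using \<beta> by (intro exI[of _ \<beta>]) (simp add: Q_def)
  qed
  \<comment> \<open>For \<open>\<alpha>\<close> in the product of the \<open>Q n\<close>, whose
    members are open, such a network is a local base at \<open>x\<close>.\<close>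
  define net where "net \<alpha> x \<longleftrightarrow> x \<in> topspace X \<and> (\<forall>n. x \<in> \<alpha> n) \<and>
      (\<forall>U. openin X U \<and> x \<in> U \<longrightarrow> (\<exists>n. \<alpha> n \<subseteq> U))" for \<alpha> :: "nat \<Rightarrow> 'a set" and x
  have netD: "x \<in> topspace X" "x \<in> \<alpha> n" "\<lbrakk>openin X U; x \<in> U\<rbrakk> \<Longrightarrow> \<exists>n. \<alpha> n \<subseteq> U"
    if "net \<alpha> x" for \<alpha> x n U
    using that by (auto simp: net_def)
  have netI: "net \<alpha> x" if "x \<in> topspace X" "\<And>n. x \<in> \<alpha> n"
      "\<And>U. \<lbrakk>openin X U; x \<in> U\<rbrakk> \<Longrightarrow> \<exists>n. \<alpha> n \<subseteq> U" for \<alpha> x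
    using that by (simp add: net_def)
  have net_unique: "x = y" if n: "net \<alpha> x" "net \<alpha> y" for \<alpha> x y
  proof (rule ccontr)
    assume "x \<noteq> y"
    then obtain U V where UV: "openin X U" "openin X V" "x \<in> U" "y \<in> V" "disjnt U V"
      using H netD(1)[OF n(1)] netD(1)[OF n(2)] unfolding Hausdorff_space_def by blast
    obtain k where "\<alpha> k \<subseteq> U" using netD(3)[OF n(1) UV(1,3)] ..
    then have "y \<in> U" using netD(2)[OF n(2), of k] by (rule subsetD)
    then show False using UV(4,5) by (auto simp: disjnt_iff)
  qed
  \<comment> \<open>Determined only on sequences with a \<open>net\<close> point, which is unique by
    the Hausdorff property.\<close>
  define f where "f \<alpha> = (THE x. net \<alpha> x)" for \<alpha>
  have f_eq: "f \<alpha> = x" if "net \<alpha> x" for \<alpha> x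
    unfolding f_def using that net_unique by (intro the_equality) auto
  define S where "S = {\<alpha> \<in> Pi\<^sub>E UNIV Q. \<exists>x. net \<alpha> x}"
  have net_f: "net \<alpha> (f \<alpha>)" if \<alpha>: "\<alpha> \<in> S" for \<alpha>
  proof -
    obtain x where "net \<alpha> x" using \<alpha> by (auto simp: S_def)
    then show ?thesis using f_eq[of \<alpha> x] by simp
  qed
  define Prod where "Prod = product_topology (\<lambda>n. discrete_topology (Q n)) (UNIV :: nat set)"
  define T where "T = subtopology Prod S"
  have top_Prod: "topspace Prod = Pi\<^sub>E UNIV Q" by (simp add: Prod_def)
  have top_T: "topspace T = S" by (auto simp: T_def top_Prod S_def)
  have cont: "continuous_map T X f"
    unfolding continuous_map_eq_topcontinuous_at topcontinuous_at_def top_T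
  proof (intro ballI conjI allI impI)
    show "f \<in> S \<rightarrow> topspace X" using netD(1)[OF net_f] by blast
    fix \<alpha> V assume \<alpha>: "\<alpha> \<in> S" and V: "openin X V \<and> f \<alpha> \<in> V"
    \<comment> \<open>One coordinate suffices: if \<open>\<beta>\<close> shares the term
      \<open>\<alpha> n\<close>, then \<open>f \<beta>\<close> lies in that term and hence in
      \<open>V\<close>.\<close>
    then obtain n where n: "\<alpha> n \<subseteq> V" using netD(3)[OF net_f[OF \<alpha>]] by auto
    have "continuous_map T (discrete_topology (Q n)) (\<lambda>\<beta>. \<beta> n)"
      unfolding T_def Prod_def
      by (intro continuous_map_from_subtopology continuous_map_product_projection) simp
    moreover have "openin (discrete_topology (Q n)) {\<alpha> n}" using \<alpha> by (auto simp: S_def)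
    ultimately have "openin T {\<beta> \<in> topspace T. \<beta> n \<in> {\<alpha> n}}"
      by (rule openin_continuous_map_preimage)
    moreover have "f \<beta> \<in> V" if "\<beta> \<in> S" "\<beta> n = \<alpha> n" for \<beta>
      using netD(2)[OF net_f[OF that(1)], of n] that(2) n by auto
    ultimately show "\<exists>U. openin T U \<and> \<alpha> \<in> U \<and> (\<forall>\<beta>\<in>U. f \<beta> \<in> V)"
      using \<alpha> by (intro exI[of _ "{\<beta> \<in> topspace T. \<beta> n \<in> {\<alpha> n}}"]) (auto simp: top_T)
  qed auto
  have surj: "f ` S = topspace X"
  proof
    show "f ` S \<subseteq> topspace X" using netD(1)[OF net_f] by blast
    show "topspace X \<subseteq> f ` S"
    proof
      fix x assume x: "x \<in> topspace X"
      obtain \<beta> where \<beta>: "\<forall>n. \<beta> n \<in> Q n \<and> x \<in> \<beta> n"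
          "\<forall>U N. openin X U \<and> x \<in> U \<longrightarrow> (\<exists>n\<ge>N. \<beta> n \<subseteq> U)"
        using extend[OF x] by (elim exE conjE)
      have net: "net \<beta> x"
      proof (rule netI[OF x])
        show "\<exists>n. \<beta> n \<subseteq> U" if "openin X U" "x \<in> U" for U
          using \<beta>(2)[rule_format, OF conjI, OF that, of 0] by auto
      qed (use \<beta>(1) in simp)
      then have "\<beta> \<in> S" using \<beta>(1) by (auto simp: S_def)
      then show "x \<in> f ` S" using f_eq[OF net] by (intro image_eqI[of _ f \<beta>]) simp_all
    qed
  qed
  have "open_map T X f"
    unfolding open_map_def
  proof (intro allI impI)
    fix W assume "openin T W"
    then obtain O' where O': "openin Prod O'" "W = O' \<inter> S" by (auto simp: T_def openin_subtopology)
    show "openin X (f ` W)"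
      unfolding openin_subopen[of X "f ` W"]
    proof
      fix z assume "z \<in> f ` W"
      then obtain \<alpha> where \<alpha>: "z = f \<alpha>" "\<alpha> \<in> O'" "\<alpha> \<in> S" using O' by blast
      obtain B where B: "finite {i. B i \<noteq> Q i}" "\<alpha> \<in> Pi\<^sub>E UNIV B" "Pi\<^sub>E UNIV B \<subseteq> O'"
        using O'(1) \<alpha>(2) unfolding Prod_def openin_product_topology_alt by auto
      obtain N where N: "\<forall>i\<in>{i. B i \<noteq> Q i}. i < N"
        using B(1) finite_nat_set_iff_bounded by blast
      \<comment> \<open>The box constrains only coordinates below \<open>N\<close>, so every point
        common to the first \<open>N\<close> terms of \<open>\<alpha>\<close> is the image of a
        sequence in the box.\<close>
      define G where "G = topspace X \<inter> \<Inter>(\<alpha> ` {..<N})"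
      have "openin X G"
      proof (cases "N = 0")
        case False
        then show ?thesis unfolding G_def using \<alpha>(3) opQ
          by (intro openin_Int openin_Inter) (auto simp: S_def PiE_iff)
      qed (simp add: G_def)
      moreover have "z \<in> G" using netD(1,2)[OF net_f[OF \<alpha>(3)]] \<alpha>(1) by (simp add: G_def)
      moreover have "G \<subseteq> f ` W"
      proof
        fix y assume y: "y \<in> G"
        then have yX: "y \<in> topspace X" by (simp add: G_def)
        obtain \<beta> where \<beta>: "\<forall>n. \<beta> n \<in> Q n \<and> y \<in> \<beta> n"
            "\<forall>U N. openin X U \<and> y \<in> U \<longrightarrow> (\<exists>n\<ge>N. \<beta> n \<subseteq> U)"
          using extend[OF yX] by (elim exE conjE)
        \<comment> \<open>\<open>\<gamma>\<close> keeps \<open>\<alpha>\<close> below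
          \<open>N\<close> to stay in the box and follows \<open>\<beta>\<close> from
          \<open>N\<close> on to close in on \<open>y\<close>.\<close>
        define \<gamma> where "\<gamma> i = (if i < N then \<alpha> i else \<beta> i)" for i
        have "\<exists>n. \<gamma> n \<subseteq> U" if U: "openin X U" "y \<in> U" for U
        proof -
          obtain n where "n \<ge> N" "\<beta> n \<subseteq> U"
            using \<beta>(2)[rule_format, OF conjI, OF U, of N] by auto
          then show ?thesis by (intro exI[of _ n]) (simp add: \<gamma>_def)
        qed
        moreover have "y \<in> \<gamma> n" for n using y \<beta>(1) by (auto simp: \<gamma>_def G_def)
        ultimately have net: "net \<gamma> y" using yX by (intro netI)
        have "\<gamma> n \<in> Q n" for n using \<alpha>(3) \<beta>(1) by (auto simp: \<gamma>_def S_def)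
        then have "\<gamma> \<in> S" using net by (auto simp: S_def)
        moreover have "\<gamma> n \<in> B n" for n
          using B(2) N \<beta>(1) by (cases "n < N") (auto simp: \<gamma>_def)
        then have "\<gamma> \<in> O'" using B(3) by auto
        ultimately have "\<gamma> \<in> W" using O'(2) by blast
        then show "y \<in> f ` W" using f_eq[OF net] by (intro image_eqI[of _ f \<gamma>]) simp_all
      qed
      ultimately show "\<exists>G. openin X G \<and> z \<in> G \<and> G \<subseteq> f ` W" by blast
    qed
  qed
  moreover have "boundary_compact_map T X f"
    unfolding boundary_compact_map_def top_T
  proof
    fix x assume x: "x \<in> topspace X"
    let ?F = "{\<alpha> \<in> S. f \<alpha> = x}"
    have clo: "closedin T ?F"
      using closedin_continuous_map_preimage[OF cont closedin_Hausdorff_singleton[OF H x]]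
      by (simp add: top_T)
    show "compactin T (T frontier_of ?F)"
    proof (cases "openin X {x}")
      case True
      then have "openin T ?F"
        using openin_continuous_map_preimage[OF cont True] by (simp add: top_T)
      then have "T frontier_of ?F = {}"
        using clo frontier_of_eq_empty[OF closedin_subset[OF clo]] by simp
      then show ?thesis by simp
    next
      case False
      then have ni: "x \<in> non_isolated X" using x by (simp add: non_isolated_def)
      \<comment> \<open>Any choice of members through \<open>x\<close> is a network, because for
        some \<open>n\<close> all members of \<open>\<P> n\<close> through \<open>x\<close> lie in
        \<open>U\<close> at once. So the fibre is a full product of finite sets, compact by
        Tychonoff's theorem.\<close>
      have F: "?F = Pi\<^sub>E UNIV (\<lambda>n. family_at (\<P> n) x)"
      proof (intro subset_antisym subsetI)
        fix \<alpha> assume "\<alpha> \<in> ?F"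
        then have "\<alpha> n \<in> {B \<in> Q n. x \<in> B}" for n
          using netD(2)[OF net_f, of \<alpha> n] by (auto simp: S_def)
        then show "\<alpha> \<in> Pi\<^sub>E UNIV (\<lambda>n. family_at (\<P> n) x)" using Q_at[OF ni] by auto
      next
        fix \<alpha> assume "\<alpha> \<in> Pi\<^sub>E UNIV (\<lambda>n. family_at (\<P> n) x)"
        then have \<alpha>: "\<alpha> n \<in> \<P> n" "x \<in> \<alpha> n" for n by (auto simp: family_at_def PiE_iff)
        have net: "net \<alpha> x"
        proof (rule netI[OF x \<alpha>(2)])
          fix U assume U: "openin X U" "x \<in> U"
          obtain n where "\<forall>P\<in>\<P> n. x \<in> P \<longrightarrow> P \<subseteq> U"
            using nbP[OF ni U] ..
          then show "\<exists>n. \<alpha> n \<subseteq> U" using \<alpha> by (intro exI[of _ n]) simp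
        qed
        have "\<alpha> \<in> Pi\<^sub>E UNIV Q" using \<alpha> by (auto simp: Q_def)
        then show "\<alpha> \<in> ?F" using f_eq[OF net] net by (auto simp: S_def)
      qed
      have "family_at (\<P> n) x \<subseteq> Q n" for n by (auto simp: family_at_def Q_def)
      then have "compactin Prod ?F"
        unfolding F Prod_def compactin_PiE using finP[OF ni] by (simp add: compactin_discrete_topology)
      then have "compactin T ?F" by (auto simp: T_def compactin_subtopology)
      moreover have "T frontier_of ?F \<subseteq> ?F" using clo by (rule frontier_of_subset_closedin)
      ultimately show ?thesis by (rule closed_compactin) (rule closedin_frontier_of)
    qed
  qed
  ultimately have obc: "open_boundary_compact_surjection T X f"
    using cont surj by (simp add: open_boundary_compact_surjection_def top_T)
  have "metrizable_space T"
    unfolding T_def Prod_def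
    by (intro metrizable_space_subtopology) (simp add: metrizable_space_product_topology)
  then obtain M d where Md: "Metric_space M d" "T = Metric_space.mtopology M d"
    unfolding metrizable_space_def by blast
  then have "T = mtopology_of (metric (M, d))" by (simp add: Metric_space.mtopology_of)
  then show ?thesis
    using obc unfolding open_boundary_compact_image_of_metric_def by blast
qed

section \<open>The equivalences\<close>

text \<open>As \<open>'m\<close> is arbitrary, the first conjunct moves a witness on any type to one
  on \<open>nat \<Rightarrow> 'a set\<close>; the condition at that fixed type thus stands for the
  existence of a metric space of whatever type.\<close>

theorem theorem3p1:
  fixes X :: "'a topology"
  assumes "Hausdorff_space X"
  shows
    "(open_boundary_compact_image_of_metric TYPE('m) X
        \<longrightarrow> open_boundary_compact_image_of_metric TYPE(nat \<Rightarrow> 'a set) X) \<and>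
     (open_boundary_compact_image_of_metric TYPE(nat \<Rightarrow> 'a set) X
        \<longleftrightarrow> (\<exists>\<P>. uniform_base_at_non_isolated X \<P>)) \<and>
     ((\<exists>\<P>. uniform_base_at_non_isolated X \<P>)
        \<longleftrightarrow> (\<exists>\<P>. point_regular_base_at_non_isolated X \<P>)) \<and>
     ((\<exists>\<P>. point_regular_base_at_non_isolated X \<P>)
        \<longleftrightarrow> (\<exists>\<P>. point_finite_development_at_non_isolated X \<P>))"
proof -
  let ?dev = "\<exists>\<P>. point_finite_development_at_non_isolated X \<P>"
  note open_boundary_compact_image_imp_development[OF assms, where ?'m = 'm]
    open_boundary_compact_image_imp_development[OF assms, where ?'m = "nat \<Rightarrow> 'a set"]
  moreover have "?dev \<Longrightarrow> open_boundary_compact_image_of_metric TYPE(nat \<Rightarrow> 'a set) X"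
    using development_imp_open_boundary_compact_image[OF assms] by blast
  moreover have "(\<exists>\<P>. point_regular_base_at_non_isolated X \<P>) \<longleftrightarrow> ?dev"
    using point_regular_base_imp_development[OF Hausdorff_imp_t1_space[OF assms]]
      development_imp_point_regular_base by blast
  ultimately show ?thesis unfolding uniform_base_iff_point_regular_base by argo
qed

end
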